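(* Let $S$ be a finite set of points in the plane $\mathbb{R}^2$. Then $S$ has infinite order if and only if $\bigcup_{i \geq 0} \mathcal{T}^{i}(S)$ is dense in $\mathbb{R}^2$.
   Context: For a set $S \subseteq \mathbb{R}^2$, let $L = \{L_i\}_{i\in I}$ be the set of lines passing through pairs of (distinct) points of $S$. Define $\mathcal{T}(S) = \bigcup_{i \neq j} L_i \cap L_j \subseteq \mathbb{R}^2$, i.e. the set of intersection points between pairs of distinct lines in $L$. If $S$ is empty or consists of collinear points, then $\mathcal{T}(S) = \emptyset$. The iterates are $\mathcal{T}^0(S) = S$ and $\mathcal{T}^{i+1}(S) = \mathcal{T}(\mathcal{T}^i(S))$. The order of $S$ is the smallest positive integer $n$ such that $\mathcal{T}^n(S) = \mathcal{T}^{n-1}(S)$; if there is no such $n$, the order of $S$ is $\infty$ ("$S$ has infinite order"). *)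

theory Defs
  imports "HOL-Analysis.Analysis" "HOL-Library.Extended_Nat"
begin

definition lines_through :: "(real^2) set \<Rightarrow> (real^2) set set" where
  "lines_through S = {affine hull {p, q} | p q. p \<in> S \<and> q \<in> S \<and> p \<noteq> q}"

definition intersection_points :: "(real^2) set \<Rightarrow> (real^2) set" where
  "intersection_points S =
     \<Union> {L \<inter> M | L M. L \<in> lines_through S \<and> M \<in> lines_through S \<and> L \<noteq> M}"

text \<open>The order counts from 1: a set fixed by \<^const>\<open>intersection_points\<close> has order 1.\<close>

definition config_order :: "(real^2) set \<Rightarrow> enat" where
  "config_order S =
     (if \<exists>n>0. (intersection_points ^^ n) S = (intersection_points ^^ (n - 1)) S
      then enat (LEAST n. n > 0 \<and> (intersection_points ^^ n) S = (intersection_points ^^ (n - 1)) S)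
      else \<infinity>)"

end

theory Submission
  imports Defs
begin

text \<open>If the order is finite, the iterates of the finite set \<open>S\<close> are eventually constant, so their union
\<open>U\<close> is finite and cannot be dense. The content is the converse.

Suppose the order is infinite. Then \<open>S\<close> is not collinear, the iterates increase, and \<open>U\<close> is an
infinite set closed under intersecting the lines it spans. The argument has two halves, linked by
the property that \<open>U\<close> contains a nondegenerate triangle together with one of its interior points.

\<^emph>\<open>An inner point exists.\<close> Assume there is none. Four points of \<open>U\<close> in general position are then in
convex position, and they form a parallelogram: if two opposite sides met, the meeting point and
two of the vertices would span a triangle around the crossing point of the diagonals
(\<open>general_quadruple_is_parallelogram\<close>). A triangle extends to a parallelogram in only three ways, so
almost all of \<open>U\<close> lies on the three sides of any given triangle, and one of these lines carries
infinitely many points of \<open>U\<close>. Two further points off that line would form, with two suitable points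
on it, a general quadruple that is not a parallelogram. So \<open>U\<close>, and with it \<open>S\<close>, lies on a line plus
one point; but such a set generates no new points at all (\<open>near_pencil_step\<close>), contradicting
infinite order.

\<^emph>\<open>An inner point gives density.\<close> Let \<open>P\<close> be a point of \<open>U\<close> inside a triangle \<open>ABC\<close> of \<open>U\<close>, and write it
as the mean of \<open>A\<close>, \<open>B\<close>, \<open>C\<close> with positive weights \<open>a\<close>, \<open>b\<close>, \<open>c\<close>. These weights are homogeneous
coordinates, and as long as all crossing points stay in the closed triangle, parallel lines do not
interfere with projective constructions. One of them adds coordinates (\<open>wmean_add\<close>), and therefore all means with
weights \<open>k * a\<close>, \<open>m * b\<close>, \<open>n * c\<close> for positive integers \<open>k\<close>, \<open>m\<close>, \<open>n\<close> belong to \<open>U\<close>; they are dense in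
the triangle. Finally, every point of the plane is the crossing point of two lines that run through
the open triangle, and the crossing point depends continuously on the points that determine the lines
(\<open>dense_if_dense_in_open\<close>).\<close>

section \<open>Orientation determinants and lines\<close>

text \<open>Twice the signed area of the triangle \<open>a b c\<close>; its vanishing is a polynomial form of collinearity.\<close>

definition orient :: "real^2 \<Rightarrow> real^2 \<Rightarrow> real^2 \<Rightarrow> real" where
  "orient a b c = (b$1 - a$1) * (c$2 - a$2) - (b$2 - a$2) * (c$1 - a$1)"

lemma orient_self [simp]: "orient a a c = 0" "orient a b b = 0" "orient a b a = 0"
  by (simp_all add: orient_def)

lemma mem_line_iff_orient:
  assumes "a \<noteq> b"
  shows "x \<in> affine hull {a, b} \<longleftrightarrow> orient a b x = 0"
proof
  assume "x \<in> affine hull {a, b}"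
  then obtain u v where uv: "u + v = 1" "x = u *\<^sub>R a + v *\<^sub>R b"
    by (auto simp: affine_hull_2)
  have u: "u = 1 - v" using uv by simp
  show "orient a b x = 0"
    by (simp add: uv(2) u orient_def algebra_simps)
next
  assume o: "orient a b x = 0"
  define v where "v = (if a$1 = b$1 then (x$2 - a$2) / (b$2 - a$2) else (x$1 - a$1) / (b$1 - a$1))"
  have ne: "a$1 \<noteq> b$1 \<or> a$2 \<noteq> b$2"
    using assms by (auto simp: vec_eq_iff forall_2)
  have "x = (1 - v) *\<^sub>R a + v *\<^sub>R b"
  proof (cases "a$1 = b$1")
    case True
    with ne o have "a$2 \<noteq> b$2" "x$1 = a$1" by (auto simp: orient_def)
    moreover have "v = (x$2 - a$2) / (b$2 - a$2)" using True by (simp add: v_def)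
    ultimately show ?thesis using True
      by (simp add: vec_eq_iff forall_2 field_simps)
  next
    case False
    then have "v = (x$1 - a$1) / (b$1 - a$1)" by (simp add: v_def)
    then have v: "v * (b$1 - a$1) = x$1 - a$1" using False by simp
    have "(b$1 - a$1) * (x$2 - a$2 - v * (b$2 - a$2)) = 0"
      using o v unfolding orient_def by algebra
    with False have "x$2 - a$2 - v * (b$2 - a$2) = 0" by simp
    with v show ?thesis
      by (simp add: vec_eq_iff forall_2 algebra_simps)
  qed
  then show "x \<in> affine hull {a, b}"
    unfolding affine_hull_2 by (metis (mono_tags, lifting) diff_add_cancel mem_Collect_eq)
qed

lemma line_point_param:
  assumes "a \<noteq> b" "orient a b x = 0"
  obtains v where "x = a + v *\<^sub>R (b - a)"
proof -
  from assms have "x \<in> affine hull {a, b}" by (simp add: mem_line_iff_orient)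
  then obtain u v where uv: "u + v = 1" "x = u *\<^sub>R a + v *\<^sub>R b"
    by (auto simp: affine_hull_2)
  have "u = 1 - v" using uv by simp
  then have "x = a + v *\<^sub>R (b - a)"
    using uv(2) by (simp add: scaleR_left_diff_distrib scaleR_right_diff_distrib)
  then show thesis by (rule that)
qed

lemma orient_zero_transfer:
  assumes "a \<noteq> b" "c \<noteq> d" "orient a b c = 0" "orient a b d = 0"
  shows "orient c d x = 0 \<longleftrightarrow> orient a b x = 0"
proof -
  obtain s where s: "c = a + s *\<^sub>R (b - a)" using assms line_point_param by blast
  obtain t where t: "d = a + t *\<^sub>R (b - a)" using assms line_point_param by blast
  have "s \<noteq> t" using assms s t by auto
  moreover have "orient c d x = (t - s) * orient a b x"
    by (simp add: s t orient_def algebra_simps)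
  ultimately show ?thesis by simp
qed

lemma line_eqI:
  assumes "a \<noteq> b" "c \<noteq> d" "orient a b c = 0" "orient a b d = 0"
  shows "affine hull {c, d} = affine hull {a, b}"
  using orient_zero_transfer[OF assms] assms by (auto simp: mem_line_iff_orient)

lemma intersection_pointsI:
  assumes "a \<in> U" "b \<in> U" "c \<in> U" "d \<in> U"
    and "orient a b c \<noteq> 0" "c \<noteq> d" "orient a b x = 0" "orient c d x = 0"
  shows "x \<in> intersection_points U"
proof -
  have ab: "a \<noteq> b" using assms by auto
  have "c \<in> affine hull {c, d}" "c \<notin> affine hull {a, b}"
    using assms ab by (auto simp: mem_line_iff_orient)
  then have "affine hull {a, b} \<noteq> affine hull {c, d}" by blast
  moreover have "affine hull {a, b} \<in> lines_through U" "affine hull {c, d} \<in> lines_through U"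
    using assms ab unfolding lines_through_def by blast+
  moreover have "x \<in> affine hull {a, b} \<inter> affine hull {c, d}"
    using assms ab by (simp add: mem_line_iff_orient)
  ultimately show ?thesis unfolding intersection_points_def by blast
qed

lemma intersection_pointsE:
  assumes "x \<in> intersection_points U"
  obtains a b c d where "a \<in> U" "b \<in> U" "c \<in> U" "d \<in> U" "a \<noteq> b"
    "orient a b c \<noteq> 0" "c \<noteq> d" "orient a b x = 0" "orient c d x = 0"
proof -
  from assms obtain a b c d where *: "a \<in> U" "b \<in> U" "c \<in> U" "d \<in> U" "a \<noteq> b" "c \<noteq> d"
    "affine hull {a, b} \<noteq> affine hull {c, d}"
    "x \<in> affine hull {a, b}" "x \<in> affine hull {c, d}"
    unfolding intersection_points_def lines_through_def by blast
  then have "orient a b x = 0" "orient c d x = 0" by (simp_all add: mem_line_iff_orient)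
  moreover have "orient d c x = - orient c d x"
    by (simp add: orient_def algebra_simps)
  moreover have "orient a b c \<noteq> 0 \<or> orient a b d \<noteq> 0"
    using line_eqI[of a b c d] *(5-7) by argo
  ultimately show thesis
    using that[OF *(1-5) _ *(6)] that[OF *(1,2,4,3,5) _ *(6)[symmetric]] by fastforce
qed

lemma lines_through_mono: "S \<subseteq> U \<Longrightarrow> lines_through S \<subseteq> lines_through U"
  unfolding lines_through_def by blast

lemma intersection_points_mono: "S \<subseteq> U \<Longrightarrow> intersection_points S \<subseteq> intersection_points U"
  using lines_through_mono[of S U] unfolding intersection_points_def by blast

lemma finite_intersection_points:
  assumes "finite S"
  shows "finite (intersection_points S)"
proof -
  have "lines_through S \<subseteq> (\<lambda>(p, q). affine hull {p, q}) ` (S \<times> S)"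
    unfolding lines_through_def by auto
  then have fin: "finite (lines_through S)"
    using assms by (meson finite_SigmaI finite_imageI finite_subset)
  have one: "finite (L \<inter> M)"
    if L: "L \<in> lines_through S" and M: "M \<in> lines_through S" and ne: "L \<noteq> M" for L M
  proof -
    obtain a b where ab: "a \<noteq> b" "L = affine hull {a, b}" using L unfolding lines_through_def by blast
    obtain c d where cd: "c \<noteq> d" "M = affine hull {c, d}" using M unfolding lines_through_def by blast
    have "x = y" if "x \<in> L \<inter> M" "y \<in> L \<inter> M" for x y
    proof (rule ccontr)
      assume "x \<noteq> y"
      have "orient a b x = 0" "orient a b y = 0" "orient c d x = 0" "orient c d y = 0"
        using that ab cd by (auto simp: mem_line_iff_orient)
      with \<open>x \<noteq> y\<close> ab cd have "affine hull {x, y} = L" "affine hull {x, y} = M"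
        using line_eqI by blast+
      with ne show False by simp
    qed
    then have "L \<inter> M = {} \<or> (\<exists>x. L \<inter> M = {x})" by blast
    then show ?thesis by auto
  qed
  have "intersection_points S \<subseteq>
      (\<Union>L\<in>lines_through S. \<Union>M\<in>lines_through S - {L}. L \<inter> M)"
    unfolding intersection_points_def by blast
  moreover have "finite (\<Union>L\<in>lines_through S. \<Union>M\<in>lines_through S - {L}. L \<inter> M)"
    using fin one by (intro finite_UN_I finite_Diff) auto
  ultimately show ?thesis by (rule finite_subset)
qed

text \<open>No point sees all sides of a nondegenerate triangle edge-on: the areas of the triangles it forms
with the three sides add up to the area of the triangle. So every point of a noncollinear set lies on
two of the lines spanned by it, and the iterates of such a set increase.\<close>

lemma subset_intersection_points:
  assumes "a \<in> S" "b \<in> S" "c \<in> S" and abc: "orient a b c \<noteq> 0"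
  shows "S \<subseteq> intersection_points S"
proof
  fix x assume x: "x \<in> S"
  have sum: "orient x a b + orient x b c + orient x c a = orient a b c"
    by (simp add: orient_def algebra_simps)
  then have "orient x a b \<noteq> 0 \<or> orient x b c \<noteq> 0 \<or> orient x c a \<noteq> 0"
    using abc by auto
  then obtain p q where pq: "p \<in> S" "q \<in> S" "orient x p q \<noteq> 0" using assms by auto
  then have "q \<noteq> x" by auto
  then show "x \<in> intersection_points S"
    using intersection_pointsI[of x S p q x x] x pq by auto
qed

lemma intersection_points_collinear:
  assumes "\<And>a b c. a \<in> S \<Longrightarrow> b \<in> S \<Longrightarrow> c \<in> S \<Longrightarrow> orient a b c = 0"
  shows "intersection_points S = {}"
proof (rule equals0I)
  fix x assume "x \<in> intersection_points S"
  then obtain a b c where "a \<in> S" "b \<in> S" "c \<in> S" "orient a b c \<noteq> 0"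
    by (rule intersection_pointsE)
  then show False using assms by blast
qed

text \<open>Two distinct lines spanned by points of a line \<open>l\<close> and one extra point \<open>p\<close> can only meet at \<open>p\<close> (if
both pass through it) or at a point of \<open>l\<close> used to span one of them (if the other is \<open>l\<close>). The case
distinction below finds this common point among the four spanning points.\<close>

lemma near_pencil_step:
  assumes pq: "u \<noteq> v" and S: "S \<subseteq> insert p {x. orient u v x = 0}"
  shows "intersection_points S \<subseteq> S"
proof
  fix x assume "x \<in> intersection_points S"
  then obtain a b c d where *: "a \<in> S" "b \<in> S" "c \<in> S" "d \<in> S" "a \<noteq> b"
    "orient a b c \<noteq> 0" "c \<noteq> d" "orient a b x = 0" "orient c d x = 0"
    by (rule intersection_pointsE)
  have line: "orient u v s = 0" if "s \<in> S" "s \<noteq> p" for s using that S by blast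
  have cl: "orient r s t = 0" if "orient u v r = 0" "orient u v s = 0" "orient u v t = 0" for r s t
    using that orient_zero_transfer[of u v r s t] pq by (cases "r = s") auto
  have uniq: "x = y" if "orient a b y = 0" "orient c d y = 0" for y
  proof (rule ccontr)
    assume "x \<noteq> y"
    then have "orient a b c = 0"
      using orient_zero_transfer[of c d x y c] orient_zero_transfer[of a b x y c] * that
      by simp
    with * show False by simp
  qed
  have on: "orient r s t = 0"
    if "r \<in> S" "s \<in> S" "t \<in> S" "r \<noteq> p" "s \<noteq> p" "t \<noteq> p" for r s t
    using cl line that by blast
  have "\<exists>y\<in>{a, b, c, d}. orient a b y = 0 \<and> orient c d y = 0"
  proof (cases "c = p \<or> d = p")
    case True
    show ?thesis
    proof (cases "a = p \<or> b = p")
      case True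
      with \<open>c = p \<or> d = p\<close> show ?thesis by auto
    next
      case False
      with True * on[of a b d] on[of a b c] show ?thesis by auto
    qed
  next
    case False
    with * on[of c d a] on[of c d b] show ?thesis by auto
  qed
  then obtain y where "y \<in> S" "orient a b y = 0" "orient c d y = 0"
    using * by auto
  then show "x \<in> S" using uniq by blast
qed

section \<open>Weighted means of the vertices of a triangle\<close>

text \<open>The weights are homogeneous coordinates of a point relative to \<open>A\<close>, \<open>B\<close>, \<open>C\<close>. They are not normalised
to sum 1, because integer multiples of the coordinates are taken later. A zero sum of weights, which
stands for a point at infinity, gives the junk value 0.\<close>

definition wmean :: "real^2 \<Rightarrow> real^2 \<Rightarrow> real^2 \<Rightarrow> real \<Rightarrow> real \<Rightarrow> real \<Rightarrow> real^2" where
  "wmean A B C x y z = (1 / (x + y + z)) *\<^sub>R (x *\<^sub>R A + y *\<^sub>R B + z *\<^sub>R C)"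

lemma scaleR_wmean:
  assumes "x + y + z \<noteq> 0"
  shows "(x + y + z) *\<^sub>R wmean A B C x y z = x *\<^sub>R A + y *\<^sub>R B + z *\<^sub>R C"
  using assms by (simp add: wmean_def)

lemma wmean_vertex [simp]: "wmean A B C 1 0 0 = A" "wmean A B C 0 1 0 = B" "wmean A B C 0 0 1 = C"
  by (simp_all add: wmean_def)

lemma wmean_permute: "wmean B C A y z x = wmean A B C x y z" "wmean B A C y x z = wmean A B C x y z"
  by (simp_all add: wmean_def add_ac)

lemma wmean_scale:
  assumes "k \<noteq> 0"
  shows "wmean A B C (k * x) (k * y) (k * z) = wmean A B C x y z"
proof -
  have "k * x + k * y + k * z = k * (x + y + z)" by (simp add: algebra_simps)
  moreover have "(k * x) *\<^sub>R A + (k * y) *\<^sub>R B + (k * z) *\<^sub>R C = k *\<^sub>R (x *\<^sub>R A + y *\<^sub>R B + z *\<^sub>R C)"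
    by (simp add: algebra_simps)
  ultimately show ?thesis using assms by (simp add: wmean_def)
qed

text \<open>In homogeneous coordinates, collinearity with respect to a nondegenerate triangle is the vanishing of
a \<open>3 \<times> 3\<close> determinant. All incidences between means of the vertices are checked by this formula.\<close>

lemma orient_wmean:
  assumes s: "x + y + z \<noteq> 0" and s': "x' + y' + z' \<noteq> 0" and s'': "x'' + y'' + z'' \<noteq> 0"
  shows "orient (wmean A B C x y z) (wmean A B C x' y' z') (wmean A B C x'' y'' z'') =
    (x * (y' * z'' - z' * y'') - y * (x' * z'' - z' * x'') + z * (x' * y'' - y' * x'')) * orient A B C
      / ((x + y + z) * (x' + y' + z') * (x'' + y'' + z''))"
proof -
  define p where "p = wmean A B C x y z"
  define q where "q = wmean A B C x' y' z'"
  define r where "r = wmean A B C x'' y'' z''"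
  define u where "u = x + y + z"
  define v where "v = x' + y' + z'"
  define w where "w = x'' + y'' + z''"
  have p: "u * p$i = x * A$i + y * B$i + z * C$i" for i
    using arg_cong[OF scaleR_wmean[OF s, of A B C], of "\<lambda>t. t$i"] by (simp add: p_def u_def)
  have q: "v * q$i = x' * A$i + y' * B$i + z' * C$i" for i
    using arg_cong[OF scaleR_wmean[OF s', of A B C], of "\<lambda>t. t$i"] by (simp add: q_def v_def)
  have r: "w * r$i = x'' * A$i + y'' * B$i + z'' * C$i" for i
    using arg_cong[OF scaleR_wmean[OF s'', of A B C], of "\<lambda>t. t$i"] by (simp add: r_def w_def)
  \<comment> \<open>The determinant of the rows \<open>(u, u p)\<close>, \<open>(v, v q)\<close>, \<open>(w, w r)\<close>, expanded along its first column.\<close>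
  have "(u * v * w) * orient p q r =
      w * ((u * p$1) * (v * q$2) - (u * p$2) * (v * q$1))
    + u * ((v * q$1) * (w * r$2) - (v * q$2) * (w * r$1))
    + v * ((w * r$1) * (u * p$2) - (w * r$2) * (u * p$1))"
    by (simp add: orient_def algebra_simps)
  also have "\<dots> = (x * (y' * z'' - z' * y'') - y * (x' * z'' - z' * x'') + z * (x' * y'' - y' * x'')) * orient A B C"
    unfolding p q r unfolding u_def v_def w_def by (simp add: orient_def algebra_simps)
  finally show ?thesis
    using assms unfolding p_def[symmetric] q_def[symmetric] r_def[symmetric]
      u_def[symmetric] v_def[symmetric] w_def[symmetric]
    by (simp add: field_simps)
qed

lemma barycentric_coordinates:
  assumes "orient A B C \<noteq> 0"
  obtains x y z where "x + y + z = 1" "D = wmean A B C x y z"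
    "x = orient B C D / orient A B C" "y = orient C A D / orient A B C"
    "z = orient A B D / orient A B C"
proof -
  define x where "x = orient B C D / orient A B C"
  define y where "y = orient C A D / orient A B C"
  define z where "z = orient A B D / orient A B C"
  have s: "x + y + z = 1"
  proof -
    have "orient B C D + orient C A D + orient A B D = orient A B C"
      by (simp add: orient_def algebra_simps)
    then show ?thesis using assms unfolding x_def y_def z_def
      by (simp add: add_divide_distrib[symmetric])
  qed
  have "orient A B C * D$i = orient B C D * A$i + orient C A D * B$i + orient A B D * C$i" if "i = 1 \<or> i = 2" for i
    using that by (auto simp: orient_def algebra_simps)
  then have "D$i = x * A$i + y * B$i + z * C$i" if "i = 1 \<or> i = 2" for i
    using assms that unfolding x_def y_def z_def by (simp add: field_simps)
  then have "D = wmean A B C x y z"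
    by (simp add: wmean_def s vec_eq_iff forall_2)
  with s show thesis by (rule that) (simp_all add: x_def y_def z_def)
qed

lemma meet_in_closed:
  assumes "intersection_points U \<subseteq> U" "a \<in> U" "b \<in> U" "c \<in> U" "d \<in> U"
    and "orient a b c \<noteq> 0" "c \<noteq> d" "orient a b x = 0" "orient c d x = 0"
  shows "x \<in> U"
  using intersection_pointsI[of a U b c d x] assms by blast

section \<open>From an inner point to density\<close>

text \<open>The line from the vertex \<open>A\<close> through the given mean meets the opposite side in the point that forgets
the first coordinate.\<close>

lemma wmean_project:
  assumes cl: "intersection_points U \<subseteq> U" and U: "A \<in> U" "B \<in> U" "C \<in> U" "wmean A B C x y z \<in> U"
    and ABC: "orient A B C \<noteq> 0" and s: "x + y + z \<noteq> 0" "y + z \<noteq> 0" "y \<noteq> 0 \<or> z \<noteq> 0"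
  shows "wmean A B C 0 y z \<in> U"
proof (cases "z = 0")
  case True
  then have "wmean A B C 0 y z = B" using s by (simp add: wmean_def)
  with U show ?thesis by simp
next
  case False
  have "orient A (wmean A B C x y z) B \<noteq> 0"
    using orient_wmean[of 1 0 0 x y z 0 1 0 A B C] False s ABC by simp
  moreover have "orient A (wmean A B C x y z) (wmean A B C 0 y z) = 0"
    using orient_wmean[of 1 0 0 x y z 0 y z A B C] s by simp
  moreover have "orient B C (wmean A B C 0 y z) = 0"
    using orient_wmean[of 0 1 0 0 0 1 0 y z A B C] s by simp
  moreover have "B \<noteq> C" using ABC by auto
  ultimately show ?thesis
    using meet_in_closed[OF cl U(1) U(4) U(2) U(3)] by simp
qed

text \<open>Projecting the two means from \<open>A\<close> and from \<open>B\<close> gives the points with coordinates \<open>(0, b, s)\<close> and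
\<open>(a, 0, t)\<close>. The line joining these contains their coordinatewise sum \<open>(a, b, s + t)\<close>, and so does the
line from \<open>C = (0, 0, 1)\<close> to \<open>(a, b, s)\<close>.\<close>

lemma wmean_add:
  assumes cl: "intersection_points U \<subseteq> U" and U: "A \<in> U" "B \<in> U" "C \<in> U"
    and ABC: "orient A B C \<noteq> 0" and pos: "a > 0" "b > 0" "s > 0" "t > 0"
    and s: "wmean A B C a b s \<in> U" and t: "wmean A B C a b t \<in> U"
  shows "wmean A B C a b (s + t) \<in> U"
proof -
  have BAC: "orient B A C \<noteq> 0" using ABC by (simp add: orient_def algebra_simps)
  have 1: "wmean A B C 0 b s \<in> U"
    using wmean_project[OF cl U s ABC] pos by simp
  have 2: "wmean A B C a 0 t \<in> U"
    using wmean_project[OF cl U(2,1,3) _ BAC, of b a t] t pos by (simp add: wmean_permute)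
  have "orient (wmean A B C 0 b s) (wmean A B C a 0 t) C \<noteq> 0"
    using orient_wmean[of 0 b s a 0 t 0 0 1 A B C] pos ABC by simp
  moreover have "C \<noteq> wmean A B C a b s"
  proof
    assume "C = wmean A B C a b s"
    then have "orient C (wmean A B C a b s) A = 0" by (metis orient_self(1))
    then show False
      using orient_wmean[of 0 0 1 a b s 1 0 0 A B C] pos ABC by simp
  qed
  moreover have "orient (wmean A B C 0 b s) (wmean A B C a 0 t) (wmean A B C a b (s + t)) = 0"
    using orient_wmean[of 0 b s a 0 t a b "s + t" A B C] pos by (simp add: algebra_simps)
  moreover have "orient C (wmean A B C a b s) (wmean A B C a b (s + t)) = 0"
    using orient_wmean[of 0 0 1 a b s a b "s + t" A B C] pos by simp
  ultimately show ?thesis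
    using meet_in_closed[OF cl 1 2 U(3) s] by simp
qed

lemma wmean_multiple:
  assumes cl: "intersection_points U \<subseteq> U" and U: "A \<in> U" "B \<in> U" "C \<in> U"
    and ABC: "orient A B C \<noteq> 0" and pos: "a > 0" "b > 0" "c > 0"
    and P: "wmean A B C a b c \<in> U" and "n > 0"
  shows "wmean A B C a b (real n * c) \<in> U"
  using \<open>n > 0\<close>
proof (induction n rule: nat_induct_non_zero)
  case 1
  then show ?case using P by simp
next
  case (Suc n)
  then have "wmean A B C a b (real n * c + c) \<in> U"
    using wmean_add[OF cl U ABC pos(1,2) _ pos(3) Suc.IH P] pos by simp
  then show ?case by (simp add: algebra_simps)
qed

text \<open>Rotating the vertices brings each weight in turn into the last position, where the previous lemma
multiplies it.\<close>

lemma wmean_multiples: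
  assumes cl: "intersection_points U \<subseteq> U" and U: "A \<in> U" "B \<in> U" "C \<in> U"
    and ABC: "orient A B C \<noteq> 0" and pos: "a > 0" "b > 0" "c > 0"
    and P: "wmean A B C a b c \<in> U" and n: "k > 0" "m > 0" "n > 0"
  shows "wmean A B C (real k * a) (real m * b) (real n * c) \<in> U"
proof -
  have rot: "orient B C A \<noteq> 0" "orient C A B \<noteq> 0"
    using ABC by (simp_all add: orient_def algebra_simps)
  have r1: "wmean B C A y z x = wmean A B C x y z" and r2: "wmean C A B z x y = wmean A B C x y z" for x y z
    by (simp_all add: wmean_def add_ac)
  have "wmean A B C a b (real n * c) \<in> U"
    using wmean_multiple[OF cl U ABC pos P n(3)] .
  then have "wmean C A B (real n * c) a (real m * b) \<in> U"
    using wmean_multiple[OF cl U(3,1,2) rot(2), of "real n * c" a b m] pos n by (simp add: r2)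
  then have "wmean B C A (real m * b) (real n * c) (real k * a) \<in> U"
    using wmean_multiple[OF cl U(2,3,1) rot(1), of "real m * b" "real n * c" a k] pos n
    by (simp add: r1 r2)
  then show ?thesis by (simp add: r1)
qed

lemma floor_ratio_tendsto:
  assumes "x > 0"
  shows "(\<lambda>n. real (Suc (nat \<lfloor>real n * x\<rfloor>)) / real n) \<longlonglongrightarrow> x"
proof (rule tendsto_sandwich)
  have b: "real n * x \<le> real (Suc (nat \<lfloor>real n * x\<rfloor>))" "real (Suc (nat \<lfloor>real n * x\<rfloor>)) \<le> real n * x + 1" for n
  proof -
    have "real (nat \<lfloor>real n * x\<rfloor>) = of_int \<lfloor>real n * x\<rfloor>" using assms by simp
    then show "real n * x \<le> real (Suc (nat \<lfloor>real n * x\<rfloor>))" "real (Suc (nat \<lfloor>real n * x\<rfloor>)) \<le> real n * x + 1"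
      by linarith+
  qed
  show "\<forall>\<^sub>F n in sequentially. x \<le> real (Suc (nat \<lfloor>real n * x\<rfloor>)) / real n"
    using eventually_gt_at_top[of 0] by eventually_elim (use b(1) in \<open>simp add: field_simps\<close>)
  show "\<forall>\<^sub>F n in sequentially. real (Suc (nat \<lfloor>real n * x\<rfloor>)) / real n \<le> x + 1 / real n"
    using eventually_gt_at_top[of 0] by eventually_elim (use b(2) in \<open>simp add: field_simps\<close>)
  show "(\<lambda>n. x + 1 / real n) \<longlonglongrightarrow> x"
    using tendsto_add[OF tendsto_const[of x] lim_1_over_n] by simp
qed simp

text \<open>Weights matter only up to a common factor. So it suffices that every positive ratio is the limit of
positive integers divided by \<open>n\<close>: means with integer multiples of the weights \<open>a\<close>, \<open>b\<close>, \<open>c\<close> are in \<open>U\<close>.\<close>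

lemma wmean_in_closure:
  assumes cl: "intersection_points U \<subseteq> U" and U: "A \<in> U" "B \<in> U" "C \<in> U"
    and ABC: "orient A B C \<noteq> 0" and pos: "a > 0" "b > 0" "c > 0"
    and P: "wmean A B C a b c \<in> U" and xyz: "x > 0" "y > 0" "z > 0"
  shows "wmean A B C x y z \<in> closure U"
proof -
  define r where "r = (\<lambda>t n. Suc (nat \<lfloor>real n * t\<rfloor>))"
  define X where "X = (\<lambda>n. wmean A B C (real (r (x/a) n) * a) (real (r (y/b) n) * b) (real (r (z/c) n) * c))"
  have X: "X n \<in> U" for n
    unfolding X_def by (rule wmean_multiples[OF cl U ABC pos P]) (simp_all add: r_def)
  have eq: "X n = wmean A B C (real (r (x/a) n) / real n * a) (real (r (y/b) n) / real n * b)
      (real (r (z/c) n) / real n * c)" if "n > 0" for n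
    using wmean_scale[of "1 / real n" A B C "real (r (x/a) n) * a" "real (r (y/b) n) * b" "real (r (z/c) n) * c"] that
    by (simp add: X_def)
  have r: "(\<lambda>n. real (r (t/w) n) / real n * w) \<longlonglongrightarrow> t" if "t > 0" "w > 0" for t w
    using tendsto_mult[OF floor_ratio_tendsto[of "t/w"] tendsto_const[of w]] that
    by (simp add: r_def)
  have "(\<lambda>n. wmean A B C (real (r (x/a) n) / real n * a) (real (r (y/b) n) / real n * b)
      (real (r (z/c) n) / real n * c)) \<longlonglongrightarrow> wmean A B C x y z"
    unfolding wmean_def
    by (intro tendsto_intros r pos xyz) (use xyz in simp)
  then have "X \<longlonglongrightarrow> wmean A B C x y z"
    by (rule Lim_transform_eventually)
       (use eventually_gt_at_top[of 0] in \<open>eventually_elim, simp add: eq\<close>)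
  with X show ?thesis unfolding closure_sequential by blast
qed

lemma tendsto_orient [tendsto_intros]:
  assumes "(a \<longlongrightarrow> a') F" "(b \<longlongrightarrow> b') F" "(c \<longlongrightarrow> c') F"
  shows "((\<lambda>x. orient (a x) (b x) (c x)) \<longlongrightarrow> orient a' b' c') F"
  unfolding orient_def by (intro tendsto_intros assms)

text \<open>The open triangle is described by the signs of three areas, which makes its openness evident.\<close>

lemma closure_contains_open_triangle:
  assumes cl: "intersection_points U \<subseteq> U" and U: "A \<in> U" "B \<in> U" "C \<in> U"
    and ABC: "orient A B C \<noteq> 0" and pos: "a > 0" "b > 0" "c > 0"
    and P: "wmean A B C a b c \<in> U"
  shows "\<exists>W. open W \<and> W \<noteq> {} \<and> W \<subseteq> closure U"
proof (intro exI conjI)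
  let ?o = "orient A B C"
  let ?W = "{D. 0 < orient B C D * ?o \<and> 0 < orient C A D * ?o \<and> 0 < orient A B D * ?o}"
  have "continuous_on UNIV (\<lambda>D. orient p q D * ?o)" for p q
    unfolding orient_def by (intro continuous_intros)
  then show "open ?W"
    by (intro open_Collect_conj open_Collect_less continuous_on_const)
  show "?W \<subseteq> closure U"
  proof
    fix D assume "D \<in> ?W"
    then have D: "0 < orient B C D / ?o" "0 < orient C A D / ?o" "0 < orient A B D / ?o"
      by (simp_all add: zero_less_mult_iff zero_less_divide_iff)
    obtain x y z where DX: "D = wmean A B C x y z" and
      xyz: "x = orient B C D / ?o" "y = orient C A D / ?o" "z = orient A B D / ?o"
      using barycentric_coordinates[OF ABC] by blast
    show "D \<in> closure U"
      unfolding DX by (rule wmean_in_closure[OF cl U ABC pos P D[folded xyz]])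
  qed
  have sq: "0 < w * ?o / v * ?o" if "w > 0" "v > 0" for w v
  proof -
    have "w * ?o / v * ?o = (w / v) * (?o * ?o)" by simp
    also have "\<dots> > 0"
      using that ABC by (metis divide_pos_pos mult_pos_pos not_real_square_gt_zero)
    finally show ?thesis .
  qed
  have "orient B C (wmean A B C a b c) = a * ?o / (a + b + c)"
    using orient_wmean[of 0 1 0 0 0 1 a b c A B C] pos by simp
  moreover have "orient C A (wmean A B C a b c) = b * ?o / (a + b + c)"
    using orient_wmean[of 0 0 1 1 0 0 a b c A B C] pos by simp
  moreover have "orient A B (wmean A B C a b c) = c * ?o / (a + b + c)"
    using orient_wmean[of 1 0 0 0 1 0 a b c A B C] pos by simp
  ultimately have "wmean A B C a b c \<in> ?W"
    using sq pos by simp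
  then show "?W \<noteq> {}" by blast
qed

text \<open>Given a target \<open>Q\<close>, take two points \<open>p\<close>, \<open>q\<close> of the open set \<open>W\<close> that are not collinear with \<open>Q\<close>, and
move each slightly towards \<open>Q\<close>, staying in \<open>W\<close>. The two resulting lines cross at \<open>Q\<close>. Approximating the
four points by points of \<open>U\<close> yields crossing points in \<open>U\<close> that converge to \<open>Q\<close>.\<close>

lemma dense_if_dense_in_open:
  assumes cl: "intersection_points U \<subseteq> U" and W: "open W" "W \<noteq> {}" "W \<subseteq> closure U"
  shows "closure U = UNIV"
proof -
  have "Q \<in> closure U" for Q
  proof -
    have near: "\<exists>t>0. p + t *\<^sub>R v \<in> W" if "p \<in> W" for p v
    proof -
      have "((\<lambda>t. p + t *\<^sub>R v) \<longlongrightarrow> p + 0 *\<^sub>R v) (at_right 0)"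
        by (intro tendsto_intros)
      then have "((\<lambda>t. p + t *\<^sub>R v) \<longlongrightarrow> p) (at_right 0)" by simp
      then have "\<forall>\<^sub>F t in at_right (0::real). p + t *\<^sub>R v \<in> W"
        using W(1) that by (rule topological_tendstoD)
      moreover have "\<forall>\<^sub>F t in at_right (0::real). t > 0"
        by (rule eventually_at_right_less)
      ultimately have "\<forall>\<^sub>F t in at_right (0::real). t > 0 \<and> p + t *\<^sub>R v \<in> W"
        by eventually_elim simp
      then show ?thesis
        using eventually_happens'[OF trivial_limit_at_right_real] by fastforce
    qed
    obtain p0 where p0: "p0 \<in> W" using W(2) by blast
    obtain p where p: "p \<in> W" "p \<noteq> Q"
    proof (cases "p0 = Q")
      case True
      obtain t where "t > 0" "p0 + t *\<^sub>R axis 1 1 \<in> W" using near[OF p0] by blast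
      then show thesis using that True by (auto simp: axis_eq_0_iff)
    qed (use p0 that in blast)
    \<comment> \<open>A direction perpendicular to \<open>Q - p\<close> leads off the line through \<open>Q\<close> and \<open>p\<close>.\<close>
    define e :: "real^2" where "e = (\<chi> i. if i = 1 then p$2 - Q$2 else Q$1 - p$1)"
    obtain s where s: "s > 0" "p + s *\<^sub>R e \<in> W" using near[OF p(1)] by blast
    define q where "q = p + s *\<^sub>R e"
    have pq: "orient Q p q \<noteq> 0"
    proof -
      have *: "orient Q p q = - (s * ((p$1 - Q$1)\<^sup>2 + (p$2 - Q$2)\<^sup>2))"
        by (simp add: q_def e_def orient_def algebra_simps power2_eq_square)
      have "(p$1 - Q$1)\<^sup>2 + (p$2 - Q$2)\<^sup>2 \<noteq> 0"
        using p(2) by (auto simp: vec_eq_iff forall_2 sum_power2_eq_zero_iff)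
      with s(1) show ?thesis unfolding * by (simp del: neg_equal_iff_equal)
    qed
    have q: "q \<in> W" using s q_def by simp
    obtain t where t: "t > 0" "p + t *\<^sub>R (Q - p) \<in> W" using near[OF p(1)] by blast
    obtain t' where t': "t' > 0" "q + t' *\<^sub>R (Q - q) \<in> W" using near[OF q] by blast
    define p' where "p' = p + t *\<^sub>R (Q - p)"
    define q' where "q' = q + t' *\<^sub>R (Q - q)"
    have "p \<in> closure U" "p' \<in> closure U" "q \<in> closure U" "q' \<in> closure U"
      using W(3) p q t t' by (auto simp: p'_def q'_def)
    then obtain a b c d where in_U: "\<And>n. a n \<in> U" "\<And>n. b n \<in> U" "\<And>n. c n \<in> U" "\<And>n. d n \<in> U"
      and lim: "a \<longlonglongrightarrow> p" "b \<longlonglongrightarrow> p'" "c \<longlonglongrightarrow> q" "d \<longlonglongrightarrow> q'"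
      unfolding closure_sequential by blast
    \<comment> \<open>Cramer's rule for the crossing point of the lines \<open>a b\<close> and \<open>c d\<close>.\<close>
    define m where "m = (\<lambda>a b c d. a + (orient c d a / (orient c d a - orient c d b)) *\<^sub>R (b - a))"
    have m_line: "orient a b (m a b c d) = 0" for a b c d
    proof -
      have "orient a b (a + u *\<^sub>R (b - a)) = 0" for u
        by (simp add: orient_def algebra_simps)
      then show ?thesis by (simp add: m_def)
    qed
    have m_line': "orient c d (m a b c d) = 0" if "orient c d a - orient c d b \<noteq> 0" for a b c d
    proof -
      have "orient c d (a + u *\<^sub>R (b - a)) = orient c d a - u * (orient c d a - orient c d b)" for u
        by (simp add: orient_def algebra_simps)
      with that show ?thesis by (simp add: m_def)
    qed
    have o1: "orient q q' p = t' * orient Q p q"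
      by (simp add: q'_def orient_def algebra_simps)
    have o2: "orient q q' p' = (1 - t) * (t' * orient Q p q)"
      by (simp add: q'_def p'_def orient_def algebra_simps)
    have o3: "orient p p' q = - (t * orient Q p q)"
      by (simp add: p'_def orient_def algebra_simps)
    have o: "orient q q' p - orient q q' p' = t * t' * orient Q p q"
      unfolding o1 o2 by (simp add: algebra_simps)
    have "m p p' q q' = p + (1 / t) *\<^sub>R (p' - p)"
      using t t' pq unfolding m_def o unfolding o1 by simp
    also have "\<dots> = Q" using t by (simp add: p'_def)
    finally have mQ: "m p p' q q' = Q" .
    have lim_m: "(\<lambda>n. m (a n) (b n) (c n) (d n)) \<longlonglongrightarrow> Q"
      unfolding mQ[symmetric] unfolding m_def
      by (intro tendsto_intros lim) (use o t t' pq in auto)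
    have "(\<lambda>n. orient (c n) (d n) (a n) - orient (c n) (d n) (b n)) \<longlonglongrightarrow> t * t' * orient Q p q"
      unfolding o[symmetric] by (intro tendsto_intros lim)
    then have e1: "\<forall>\<^sub>F n in sequentially. orient (c n) (d n) (a n) - orient (c n) (d n) (b n) \<noteq> 0"
      by (rule tendsto_imp_eventually_ne) (use t t' pq in simp)
    have "(\<lambda>n. orient (a n) (b n) (c n)) \<longlonglongrightarrow> - (t * orient Q p q)"
      unfolding o3[symmetric] by (intro tendsto_intros lim)
    then have e2: "\<forall>\<^sub>F n in sequentially. orient (a n) (b n) (c n) \<noteq> 0"
      by (rule tendsto_imp_eventually_ne) (use t pq in simp)
    have "\<forall>\<^sub>F n in sequentially. m (a n) (b n) (c n) (d n) \<in> U"
      using e1 e2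
    proof eventually_elim
      case (elim n)
      then have "c n \<noteq> d n" by auto
      with elim show ?case
        using meet_in_closed[OF cl in_U] m_line m_line' by blast
    qed
    then have "\<forall>\<^sub>F n in sequentially. m (a n) (b n) (c n) (d n) \<in> closure U"
      by eventually_elim (use closure_subset in blast)
    then show ?thesis
      by (rule Lim_in_closed_set[OF closed_closure _ sequentially_bot lim_m])
  qed
  then show ?thesis by blast
qed

section \<open>Closed sets without an inner point\<close>

text \<open>Positivity of the weights says that the point lies in the interior of the triangle \<open>ABC\<close>.\<close>

definition has_inner_point :: "(real^2) set \<Rightarrow> bool" where
  "has_inner_point U \<longleftrightarrow> (\<exists>A\<in>U. \<exists>B\<in>U. \<exists>C\<in>U. \<exists>a>0. \<exists>b>0. \<exists>c>0.
     orient A B C \<noteq> 0 \<and> wmean A B C a b c \<in> U)"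

lemma has_inner_pointI:
  assumes "A \<in> U" "B \<in> U" "C \<in> U" "D \<in> U" "orient A B C \<noteq> 0"
    and "a > 0" "b > 0" "c > 0" "(a + b + c) *\<^sub>R D = a *\<^sub>R A + b *\<^sub>R B + c *\<^sub>R C"
  shows "has_inner_point U"
proof -
  have "wmean A B C a b c = (1 / (a + b + c)) *\<^sub>R ((a + b + c) *\<^sub>R D)"
    by (simp add: wmean_def assms(9))
  then have "wmean A B C a b c = D" using assms(6-8) by simp
  then show ?thesis unfolding has_inner_point_def using assms by blast
qed

text \<open>The sign pattern says that \<open>A B C D\<close> is a convex quadrilateral with diagonals \<open>AC\<close> and \<open>BD\<close>, and
\<open>x \<noteq> 1\<close> says that the sides \<open>AD\<close> and \<open>BC\<close> are not parallel. Their meeting point \<open>X\<close> lies beyond \<open>D\<close>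
and \<open>C\<close> if \<open>x < 1\<close>, and beyond \<open>A\<close> and \<open>B\<close> if \<open>x > 1\<close>. The crossing point \<open>O'\<close> of the diagonals lies
inside the triangle \<open>A X B\<close> in the first case and inside \<open>D X C\<close> in the second.\<close>

lemma has_inner_point_convex:
  assumes cl: "intersection_points U \<subseteq> U" and U: "A \<in> U" "B \<in> U" "C \<in> U" "D \<in> U"
    and ABC: "orient A B C \<noteq> 0" and D: "D = wmean A B C x y z" and sum: "x + y + z = 1"
    and sgn: "x > 0" "y < 0" "z > 0" and x1: "x \<noteq> 1"
  shows "has_inner_point U"
proof -
  have yz: "y + z = 1 - x" "y + z \<noteq> 0" using sum x1 by auto
  have xz: "x + z = 1 - y" "x + z \<noteq> 0" using sum sgn by auto
  have D': "D = x *\<^sub>R A + y *\<^sub>R B + z *\<^sub>R C" using D sum by (simp add: wmean_def)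
  define X where "X = wmean A B C 0 y z"
  define O' where "O' = wmean A B C x 0 z"
  have X: "(1 - x) *\<^sub>R X = y *\<^sub>R B + z *\<^sub>R C"
    using scaleR_wmean[of 0 y z A B C] yz by (simp add: X_def)
  have O': "(x + z) *\<^sub>R O' = x *\<^sub>R A + z *\<^sub>R C"
    using scaleR_wmean[of x 0 z A B C] xz by (simp add: O'_def)
  have XU: "X \<in> U"
    unfolding X_def using wmean_project[OF cl U(1-3) _ ABC, of x y z] U(4) D sum yz sgn by simp
  have BAC: "orient B A C \<noteq> 0" using ABC by (simp add: orient_def algebra_simps)
  have OU: "O' \<in> U"
    unfolding O'_def using wmean_project[OF cl U(2,1,3) _ BAC, of y x z] U(4) D sum xz sgn
    by (simp add: wmean_permute add_ac)
  show ?thesis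
  proof (cases "x < 1")
    case True
    have "orient A X B \<noteq> 0"
      using orient_wmean[of 1 0 0 0 y z 0 1 0 A B C] yz sgn ABC by (simp add: X_def)
    moreover have "(x + (1 - x) + - y) *\<^sub>R O' = x *\<^sub>R A + (1 - x) *\<^sub>R X + (- y) *\<^sub>R B"
      unfolding X using O' xz by simp
    ultimately show ?thesis
      using has_inner_pointI[OF U(1) XU U(2) OU, of x "1 - x" "- y"] sgn True by simp
  next
    case False
    then have "x > 1" using x1 by simp
    have "orient D X C \<noteq> 0"
      using orient_wmean[of x y z 0 y z 0 0 1 A B C] yz sgn ABC sum by (simp add: X_def D)
    moreover have "(1 + (x - 1) + z) *\<^sub>R O' = 1 *\<^sub>R D + (x - 1) *\<^sub>R X + z *\<^sub>R C"
    proof -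
      have "(x - 1) *\<^sub>R X = - ((1 - x) *\<^sub>R X)" by (simp add: algebra_simps)
      then show ?thesis unfolding X using O' D' by simp
    qed
    ultimately show ?thesis
      using has_inner_pointI[OF U(4) XU U(3) OU, of 1 "x - 1" z] sgn \<open>x > 1\<close> by simp
  qed
qed

text \<open>The two pairs of opposite sides are exchanged by swapping \<open>A\<close> and \<open>C\<close>, so both pairs are parallel,
which forces \<open>x = z = 1\<close>.\<close>

lemma convex_quadrilateral_is_parallelogram:
  assumes cl: "intersection_points U \<subseteq> U" and no: "\<not> has_inner_point U"
    and U: "A \<in> U" "B \<in> U" "C \<in> U" "D \<in> U"
    and ABC: "orient A B C \<noteq> 0" and D: "D = wmean A B C x y z" and sum: "x + y + z = 1"
    and sgn: "x > 0" "y < 0" "z > 0"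
  shows "D = A + C - B"
proof -
  have "x = 1" using has_inner_point_convex[OF cl U ABC D sum sgn] no by blast
  moreover have "z = 1"
  proof (rule ccontr)
    assume "z \<noteq> 1"
    moreover have "D = wmean C B A z y x" using D by (simp add: wmean_def add_ac)
    moreover have "orient C B A \<noteq> 0" using ABC by (simp add: orient_def algebra_simps)
    ultimately show False
      using has_inner_point_convex[OF cl U(3,2,1,4), of z y x] no sum sgn by (simp add: add_ac)
  qed
  moreover have "y = -1" using calculation sum by simp
  ultimately show ?thesis using D by (simp add: wmean_def)
qed

text \<open>Solving for \<open>A\<close> turns two negative weights of \<open>D\<close> into positive weights of \<open>A\<close> in the triangle \<open>D B C\<close>.\<close>

lemma no_negative_pair:
  assumes no: "\<not> has_inner_point U"
    and U: "A \<in> U" "B \<in> U" "C \<in> U" "D \<in> U"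
    and ABC: "orient A B C \<noteq> 0" and D: "D = wmean A B C x y z" and sum: "x + y + z = 1"
  shows "\<not> (y < 0 \<and> z < 0)"
proof
  assume neg: "y < 0 \<and> z < 0"
  have D': "D = x *\<^sub>R A + y *\<^sub>R B + z *\<^sub>R C" using D sum by (simp add: wmean_def)
  have x: "x > 0" using neg sum by linarith
  have "orient D B C \<noteq> 0"
    using orient_wmean[of x y z 0 1 0 0 0 1 A B C] sum x ABC by (simp add: D)
  moreover have "(1 + - y + - z) *\<^sub>R A = 1 *\<^sub>R D + (- y) *\<^sub>R B + (- z) *\<^sub>R C"
  proof -
    have "1 + - y + - z = x" using sum by simp
    then show ?thesis by (simp add: D')
  qed
  ultimately show False
    using has_inner_pointI[OF U(4,2,3,1), of 1 "-y" "-z"] neg no by simp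
qed

text \<open>The four points are in general position, so the weights of \<open>D\<close> are nonzero. Three positive weights or
two negative ones produce an inner point. Exactly one weight is therefore negative, and its vertex is
the one opposite to \<open>D\<close> in the parallelogram.\<close>

lemma general_quadruple_is_parallelogram:
  assumes cl: "intersection_points U \<subseteq> U" and no: "\<not> has_inner_point U"
    and U: "A \<in> U" "B \<in> U" "C \<in> U" "D \<in> U"
    and ABC: "orient A B C \<noteq> 0"
    and gen: "orient B C D \<noteq> 0" "orient C A D \<noteq> 0" "orient A B D \<noteq> 0"
  shows "D \<in> {B + C - A, A + C - B, A + B - C}"
proof -
  obtain x y z where sum: "x + y + z = 1" and D: "D = wmean A B C x y z" and
    xyz: "x = orient B C D / orient A B C" "y = orient C A D / orient A B C"
    "z = orient A B D / orient A B C"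
    using barycentric_coordinates[OF ABC] by blast
  have ne: "x \<noteq> 0" "y \<noteq> 0" "z \<noteq> 0" unfolding xyz using ABC gen by simp_all
  have rot: "orient B C A \<noteq> 0" "orient C A B \<noteq> 0"
    using ABC by (simp_all add: orient_def algebra_simps)
  have D1: "D = wmean B C A y z x" and D2: "D = wmean C A B z x y"
    using D by (simp_all add: wmean_def add_ac)
  have sum1: "y + z + x = 1" and sum2: "z + x + y = 1" using sum by simp_all
  have pos: "\<not> (x > 0 \<and> y > 0 \<and> z > 0)"
    using no U ABC D unfolding has_inner_point_def by blast
  have "\<not> (y < 0 \<and> z < 0)" "\<not> (z < 0 \<and> x < 0)" "\<not> (x < 0 \<and> y < 0)"
    using no_negative_pair[OF no U ABC D sum] no_negative_pair[OF no U(2,3,1,4) rot(1) D1 sum1]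
      no_negative_pair[OF no U(3,1,2,4) rot(2) D2 sum2] by blast+
  with pos ne consider "x > 0" "y < 0" "z > 0" | "y > 0" "z < 0" "x > 0" | "z > 0" "x < 0" "y > 0"
    by linarith
  then show ?thesis
  proof cases
    case 1
    then show ?thesis using convex_quadrilateral_is_parallelogram[OF cl no U ABC D sum] by simp
  next
    case 2
    then show ?thesis
      using convex_quadrilateral_is_parallelogram[OF cl no U(2,3,1,4) rot(1) D1 sum1] by (simp add: add_ac)
  next
    case 3
    then show ?thesis
      using convex_quadrilateral_is_parallelogram[OF cl no U(3,1,2,4) rot(2) D2 sum2] by (simp add: add_ac)
  qed
qed

text \<open>Two points \<open>P\<close>, \<open>Q\<close> off a line leave only finitely many choices of \<open>X\<close>, \<open>Y\<close> on it to be excluded: the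
meeting point with the line \<open>PQ\<close>, and for fixed \<open>X\<close> the three points \<open>Y\<close> for which \<open>X\<close>, \<open>Y\<close>, \<open>P\<close>,
\<open>Q\<close> are the vertices of a parallelogram.\<close>

lemma at_most_one_off_rich_line:
  assumes cl: "intersection_points U \<subseteq> U" and no: "\<not> has_inner_point U"
    and ab: "a \<noteq> b" and inf: "infinite (U \<inter> {x. orient a b x = 0})"
    and P: "P \<in> U" "orient a b P \<noteq> 0" and Q: "Q \<in> U" "orient a b Q \<noteq> 0"
  shows "P = Q"
proof (rule ccontr)
  assume PQ: "P \<noteq> Q"
  let ?L = "U \<inter> {x. orient a b x = 0}"
  have "x = y" if "orient a b x = 0" "orient a b y = 0" "orient P Q x = 0" "orient P Q y = 0" for x y
  proof (rule ccontr)
    assume "x \<noteq> y"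
    then have "orient a b P = 0"
      using orient_zero_transfer[OF ab, of x y P] orient_zero_transfer[OF PQ, of x y P] that by simp
    with P show False by simp
  qed
  then have "?L \<inter> {x. orient P Q x = 0} = {} \<or> (\<exists>x. ?L \<inter> {x. orient P Q x = 0} = {x})" by blast
  then have "finite (?L \<inter> {x. orient P Q x = 0})" by auto
  moreover have "?L = (?L \<inter> {x. orient P Q x = 0}) \<union> (?L - {x. orient P Q x = 0})" by blast
  ultimately have inf': "infinite (?L - {x. orient P Q x = 0})"
    using inf by (metis (no_types, lifting) finite_Un)
  then have "?L - {x. orient P Q x = 0} \<noteq> {}" by (rule infinite_imp_nonempty)
  then obtain X where X: "X \<in> U" "orient a b X = 0" "orient P Q X \<noteq> 0" by blast
  have "infinite (?L - {x. orient P Q x = 0} - {X, Q + P - X, X + P - Q, Q + X - P})"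
    using inf' by simp
  then have "?L - {x. orient P Q x = 0} - {X, Q + P - X, X + P - Q, Q + X - P} \<noteq> {}"
    by (rule infinite_imp_nonempty)
  then obtain Y where Y: "Y \<in> U" "orient a b Y = 0" "orient P Q Y \<noteq> 0" "X \<noteq> Y"
    "Y \<noteq> Q + P - X" "Y \<noteq> X + P - Q" "Y \<noteq> Q + X - P" by blast
  have "orient X Y P \<noteq> 0" "orient X Y Q \<noteq> 0"
    using orient_zero_transfer[OF ab Y(4) X(2) Y(2)] P Q by simp_all
  moreover have "orient Y P Q \<noteq> 0" "orient P X Q \<noteq> 0"
    using X(3) Y(3) by (simp_all add: orient_def algebra_simps)
  ultimately have "Q \<in> {Y + P - X, X + P - Y, X + Y - P}"
    using general_quadruple_is_parallelogram[OF cl no X(1) Y(1) P(1) Q(1)] by blast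
  with Y show False by (auto simp: algebra_simps)
qed

text \<open>Apart from three points, \<open>U\<close> is covered by the three sides of the triangle, so one of these lines is
rich enough for the previous lemma.\<close>

lemma near_pencil_if_no_inner_point:
  assumes cl: "intersection_points U \<subseteq> U" and no: "\<not> has_inner_point U" and inf: "infinite U"
    and U: "A \<in> U" "B \<in> U" "C \<in> U" and ABC: "orient A B C \<noteq> 0"
  shows "\<exists>p u v. u \<noteq> v \<and> U \<subseteq> insert p {x. orient u v x = 0}"
proof -
  have "U \<subseteq> (U \<inter> {x. orient B C x = 0}) \<union> (U \<inter> {x. orient C A x = 0}) \<union> (U \<inter> {x. orient A B x = 0})
      \<union> {B + C - A, A + C - B, A + B - C}"
    using general_quadruple_is_parallelogram[OF cl no U _ ABC] by blast
  then have "infinite (U \<inter> {x. orient B C x = 0}) \<or> infinite (U \<inter> {x. orient C A x = 0})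
      \<or> infinite (U \<inter> {x. orient A B x = 0})"
    using inf by (meson finite.emptyI finite.insertI finite_UnI finite_subset)
  moreover have "B \<noteq> C" "C \<noteq> A" "A \<noteq> B" using ABC by auto
  ultimately obtain u v where uv: "u \<noteq> v" "infinite (U \<inter> {x. orient u v x = 0})" by blast
  obtain p where "\<And>x. x \<in> U \<Longrightarrow> orient u v x \<noteq> 0 \<Longrightarrow> x = p"
    using at_most_one_off_rich_line[OF cl no uv] by blast
  then have "U \<subseteq> insert p {x. orient u v x = 0}" by blast
  with uv(1) show ?thesis by blast
qed

lemma dense_if_inner_point:
  assumes cl: "intersection_points U \<subseteq> U" and "has_inner_point U"
  shows "closure U = UNIV"
proof -
  obtain A B C a b c where "A \<in> U" "B \<in> U" "C \<in> U" "orient A B C \<noteq> 0" "a > 0" "b > 0" "c > 0"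
    "wmean A B C a b c \<in> U"
    using assms(2) unfolding has_inner_point_def by blast
  then obtain W where "open W" "W \<noteq> {}" "W \<subseteq> closure U"
    using closure_contains_open_triangle[OF cl, of A B C a b c] by blast
  then show ?thesis by (rule dense_if_dense_in_open[OF cl])
qed

section \<open>The iterates and their union\<close>

lemma config_order_eq_infinity_iff:
  "config_order S = \<infinity> \<longleftrightarrow> (\<forall>n. (intersection_points ^^ Suc n) S \<noteq> (intersection_points ^^ n) S)"
proof -
  have "(\<exists>n>0. (intersection_points ^^ n) S = (intersection_points ^^ (n - 1)) S)
      \<longleftrightarrow> (\<exists>n. (intersection_points ^^ Suc n) S = (intersection_points ^^ n) S)"
    by (metis Suc_pred' diff_Suc_1 zero_less_Suc)
  moreover have "config_order S = \<infinity> \<longleftrightarrow>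
      \<not> (\<exists>n>0. (intersection_points ^^ n) S = (intersection_points ^^ (n - 1)) S)"
    unfolding config_order_def by (simp only: split: if_split) simp
  ultimately show ?thesis by blast
qed

lemma finite_iterates: "finite S \<Longrightarrow> finite ((intersection_points ^^ n) S)"
  by (induction n) (simp_all add: finite_intersection_points)

lemma finite_Union_iterates:
  assumes "finite S" and stable: "(intersection_points ^^ Suc n) S = (intersection_points ^^ n) S"
  shows "finite (\<Union>i. (intersection_points ^^ i) S)"
proof -
  have "(intersection_points ^^ (n + k)) S = (intersection_points ^^ n) S" for k
    using stable by (induction k) simp_all
  then have late: "(intersection_points ^^ i) S = (intersection_points ^^ n) S" if "n \<le> i" for i
    using that le_Suc_ex by blast
  have "(intersection_points ^^ i) S \<subseteq> (\<Union>j\<le>n. (intersection_points ^^ j) S)" for i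
  proof (cases "i \<le> n")
    case False
    then have "(intersection_points ^^ i) S = (intersection_points ^^ n) S" by (intro late) simp
    then show ?thesis by blast
  qed blast
  then have "(\<Union>i. (intersection_points ^^ i) S) \<subseteq> (\<Union>j\<le>n. (intersection_points ^^ j) S)" by blast
  moreover have "finite (\<Union>j\<le>n. (intersection_points ^^ j) S)"
    using assms(1) by (simp add: finite_iterates)
  ultimately show ?thesis by (rule finite_subset)
qed

text \<open>Since the iterates increase, the four points that span two lines of the union already lie in a common
iterate, and the crossing point lies in the next one.\<close>

lemma Union_iterates_closed:
  assumes mono: "S \<subseteq> intersection_points S"
  defines "U \<equiv> \<Union>i. (intersection_points ^^ i) S"
  shows "incseq (\<lambda>i. (intersection_points ^^ i) S)" and "intersection_points U \<subseteq> U"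
proof -
  show inc: "incseq (\<lambda>i. (intersection_points ^^ i) S)"
  proof (rule incseq_SucI)
    show "(intersection_points ^^ i) S \<subseteq> (intersection_points ^^ Suc i) S" for i
      using mono by (induction i) (simp_all add: intersection_points_mono)
  qed
  show "intersection_points U \<subseteq> U"
  proof
    fix x assume "x \<in> intersection_points U"
    then obtain a b c d where *: "a \<in> U" "b \<in> U" "c \<in> U" "d \<in> U" "a \<noteq> b"
      "orient a b c \<noteq> 0" "c \<noteq> d" "orient a b x = 0" "orient c d x = 0"
      by (rule intersection_pointsE)
    from *(1-4) obtain i j k l where "a \<in> (intersection_points ^^ i) S" "b \<in> (intersection_points ^^ j) S"
      "c \<in> (intersection_points ^^ k) S" "d \<in> (intersection_points ^^ l) S"
      unfolding U_def by blast
    moreover define n where "n = max (max i j) (max k l)"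
    moreover have "(intersection_points ^^ i) S \<subseteq> (intersection_points ^^ n) S"
      "(intersection_points ^^ j) S \<subseteq> (intersection_points ^^ n) S"
      "(intersection_points ^^ k) S \<subseteq> (intersection_points ^^ n) S"
      "(intersection_points ^^ l) S \<subseteq> (intersection_points ^^ n) S"
      using incseqD[OF inc] by (simp_all add: n_def)
    ultimately have "x \<in> intersection_points ((intersection_points ^^ n) S)"
      using intersection_pointsI[of a "(intersection_points ^^ n) S" b c d x] * by blast
    then have "x \<in> (intersection_points ^^ Suc n) S" by simp
    then show "x \<in> U" unfolding U_def by blast
  qed
qed

lemma infinite_Union_strict_chain:
  fixes F :: "nat \<Rightarrow> 'a set"
  assumes inc: "incseq F" and strict: "\<And>n. F (Suc n) \<noteq> F n"
  shows "infinite (\<Union>i. F i)"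
proof
  assume fin: "finite (\<Union>i. F i)"
  have "n \<le> card (F n)" for n
  proof (induction n)
    case (Suc n)
    have "F n \<subset> F (Suc n)" using incseqD[OF inc, of n "Suc n"] strict[of n] by auto
    moreover have "finite (F (Suc n))" using fin by (rule finite_subset[rotated]) blast
    ultimately have "card (F n) < card (F (Suc n))" by (simp add: psubset_card_mono)
    with Suc show ?case by simp
  qed simp
  moreover have "card (F n) \<le> card (\<Union>i. F i)" for n
    using fin by (intro card_mono) blast+
  ultimately have "Suc (card (\<Union>i. F i)) \<le> card (\<Union>i. F i)" by (meson order_trans)
  then show False by simp
qed

theorem theorem1p3:
  fixes S :: "(real^2) set"
  assumes "finite S"
  shows "config_order S = \<infinity> \<longleftrightarrow>
         closure (\<Union>i. (intersection_points ^^ i) S) = UNIV"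
proof
  let ?F = "\<lambda>i. (intersection_points ^^ i) S"
  let ?U = "\<Union>i. ?F i"
  assume "config_order S = \<infinity>"
  then have ne: "?F (Suc n) \<noteq> ?F n" for n unfolding config_order_eq_infinity_iff by blast
  \<comment> \<open>A collinear set is sent to the empty set, which is fixed, so its order is at most 2.\<close>
  have "\<exists>a\<in>S. \<exists>b\<in>S. \<exists>c\<in>S. orient a b c \<noteq> 0"
  proof (rule ccontr)
    assume "\<not> ?thesis"
    then have "?F 1 = {}" by (simp add: intersection_points_collinear)
    moreover have "intersection_points {} = {}" by (rule intersection_points_collinear) auto
    ultimately show False using ne[of 1] by simp
  qed
  then obtain A B C where ABC: "A \<in> S" "B \<in> S" "C \<in> S" "orient A B C \<noteq> 0" by blast
  then have S: "S \<subseteq> intersection_points S" by (rule subset_intersection_points)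
  have cl: "intersection_points ?U \<subseteq> ?U" by (rule Union_iterates_closed(2)[OF S])
  have inf: "infinite ?U"
    by (rule infinite_Union_strict_chain[OF Union_iterates_closed(1)[OF S] ne])
  have "?F 0 \<subseteq> ?U" by blast
  then have SU: "S \<subseteq> ?U" by simp
  have "has_inner_point ?U"
  proof (rule ccontr)
    assume "\<not> has_inner_point ?U"
    then obtain p u v where "u \<noteq> v" "?U \<subseteq> insert p {x. orient u v x = 0}"
      using near_pencil_if_no_inner_point[OF cl _ inf subsetD[OF SU ABC(1)] subsetD[OF SU ABC(2)]
        subsetD[OF SU ABC(3)] ABC(4)] by blast
    then have "intersection_points S \<subseteq> S"
      using near_pencil_step[OF _ subset_trans[OF SU]] by blast
    with S ne[of 0] show False by simp
  qed
  then show "closure ?U = UNIV" by (rule dense_if_inner_point[OF cl])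
next
  let ?U = "\<Union>i. (intersection_points ^^ i) S"
  assume dense: "closure ?U = UNIV"
  show "config_order S = \<infinity>"
    unfolding config_order_eq_infinity_iff
  proof (intro allI notI)
    fix n assume "(intersection_points ^^ Suc n) S = (intersection_points ^^ n) S"
    then have "finite ?U" using assms by (intro finite_Union_iterates)
    then have "closed ?U" by (rule finite_imp_closed)
    with dense have "?U = UNIV" by simp
    with \<open>finite ?U\<close> have "finite (UNIV :: (real^2) set)" by simp
    then show False using finite_imp_bounded not_bounded_UNIV by blast
  qed
qed

end
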